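(* Let $p=p(n)$ be a function with $n\,p(n)\to\infty$ as $n\to\infty$. For every $n$, let $T$ be a random tournament on alternatives $x_1,\dots,x_n$ generated according to the generalized random model with probabilities $p_{i,j}\ge p(n)$ for all $i\neq j$ (i.e., $p_{i,j}\in\omega(1/n)$ uniformly over all pairs). Then with high probability (i.e., with probability tending to $1$ as $n\to\infty$), every alternative in $T$ is a $6$-king.
   Context: A tournament on a finite set $V$ of alternatives is a complete orientation: for every two distinct $x,y\in V$ exactly one of $x\succ y$ ("$x$ dominates $y$") or $y\succ x$ holds. For an integer $k\ge 2$, an alternative $x$ is a $k$-king if for every other alternative $y$ there is a directed path from $x$ to $y$ of length (number of edges) at most $k$. Generalized random model: for each ordered pair $i\neq j$ there is a number $p_{i,j}\in[0,1]$ with $p_{i,j}+p_{j,i}=1$; independently for each unordered pair $\{i,j\}$, $x_i\succ x_j$ with probability $p_{i,j}$ and otherwise $x_j\succ x_i$. *)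

theory Defs
  imports "HOL-Probability.Probability" "Graph_Theory.Graph_Theory"
begin

definition tournament :: "'a pair_pre_digraph \<Rightarrow> bool" where
  "tournament G \<longleftrightarrow> pair_fin_digraph G \<and> pair_loopfree_digraph G \<and>
     (\<forall>x\<in>pverts G. \<forall>y\<in>pverts G. x \<noteq> y \<longrightarrow> ((x, y) \<in> parcs G) \<noteq> ((y, x) \<in> parcs G))"

text \<open>An arc \<open>(x, y)\<close> means that \<open>x\<close> dominates \<open>y\<close>. A path is a list of arcs, so its length is
  the number of its edges.\<close>

definition k_king :: "nat \<Rightarrow> 'a pair_pre_digraph \<Rightarrow> 'a \<Rightarrow> bool" where
  "k_king k G x \<longleftrightarrow> x \<in> pverts G \<and>
     (\<forall>y\<in>pverts G. y \<noteq> x \<longrightarrow> (\<exists>w. pre_digraph.apath (with_proj G) x w y \<and> length w \<le> k))"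

text \<open>The unordered pairs of alternatives are represented by the pairs \<open>(i, j)\<close> with \<open>i < j\<close>.
  The coin of such a pair is \<open>True\<close> iff \<open>i\<close> dominates \<open>j\<close>.\<close>

definition alt_pairs :: "nat \<Rightarrow> (nat \<times> nat) set" where
  "alt_pairs n = {(i, j). 1 \<le> i \<and> i < j \<and> j \<le> n}"

definition coin_tournament :: "nat \<Rightarrow> (nat \<times> nat \<Rightarrow> bool) \<Rightarrow> nat pair_pre_digraph" where
  "coin_tournament n c = \<lparr> pverts = {1..n},
     parcs = {(i, j) \<in> alt_pairs n. c (i, j)} \<union> {(j, i) | i j. (i, j) \<in> alt_pairs n \<and> \<not> c (i, j)} \<rparr>"

text \<open>\<open>Pi_pmf A d q\<close> makes the coordinates in \<open>A\<close> independent with laws \<open>q\<close>; \<open>d\<close> is the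
  irrelevant value outside \<open>A\<close>. Only the entries \<open>p i j\<close> with \<open>i < j\<close> are used; the other
  orientation then has probability \<open>1 - p i j = p j i\<close>, see \<open>prob_arc_random_tournament\<close> below.\<close>

definition random_tournament :: "nat \<Rightarrow> (nat \<Rightarrow> nat \<Rightarrow> real) \<Rightarrow> nat pair_pre_digraph pmf" where
  "random_tournament n p =
     map_pmf (coin_tournament n) (Pi_pmf (alt_pairs n) False (\<lambda>(i, j). bernoulli_pmf (p i j)))"

definition pairwise_probs :: "nat \<Rightarrow> (nat \<Rightarrow> nat \<Rightarrow> real) \<Rightarrow> bool" where
  "pairwise_probs n p \<longleftrightarrow>
     (\<forall>i\<in>{1..n}. \<forall>j\<in>{1..n}. i \<noteq> j \<longrightarrow> p i j \<in> {0..1} \<and> p i j + p j i = 1)"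

lemma finite_alt_pairs [simp]: "finite (alt_pairs n)"
  by (rule finite_subset[of _ "{1..n} \<times> {1..n}"]) (auto simp: alt_pairs_def)

lemma tournament_coin_tournament: "tournament (coin_tournament n c)"
proof -
  have sub: "parcs (coin_tournament n c) \<subseteq> {1..n} \<times> {1..n}"
    by (auto simp: coin_tournament_def alt_pairs_def)
  then have fin: "finite (parcs (coin_tournament n c))"
    by (rule finite_subset) simp
  have "pair_fin_digraph (coin_tournament n c)"
    using fin by unfold_locales (auto simp: coin_tournament_def alt_pairs_def)
  moreover have "pair_loopfree_digraph (coin_tournament n c)"
    by unfold_locales (auto simp: coin_tournament_def alt_pairs_def)
  moreover have "((x, y) \<in> parcs (coin_tournament n c)) \<noteq> ((y, x) \<in> parcs (coin_tournament n c))"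
    if "x \<in> {1..n}" "y \<in> {1..n}" "x \<noteq> y" for x y
    using that by (cases "x < y") (auto simp: coin_tournament_def alt_pairs_def)
  ultimately show ?thesis
    by (auto simp: tournament_def coin_tournament_def)
qed

lemma tournament_random_tournament:
  "T \<in> set_pmf (random_tournament n p) \<Longrightarrow> tournament T \<and> pverts T = {1..n}"
  by (auto simp: random_tournament_def tournament_coin_tournament)
     (auto simp: coin_tournament_def)

lemma prob_arc_random_tournament:
  assumes "pairwise_probs n p" "i \<in> {1..n}" "j \<in> {1..n}" "i \<noteq> j"
  shows "measure_pmf.prob (random_tournament n p) {T. (i, j) \<in> parcs T} = p i j"
proof -
  let ?P = "Pi_pmf (alt_pairs n) False (\<lambda>(i, j). bernoulli_pmf (p i j))"
  have coin: "measure_pmf.prob ?P {c. c (a, b) = v} = (if v then p a b else 1 - p a b)"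
    if ab: "(a, b) \<in> alt_pairs n" for a b v
  proof -
    have "p a b \<in> {0..1}"
      using ab assms(1) by (auto simp: pairwise_probs_def alt_pairs_def)
    moreover have "measure_pmf.prob ?P {c. c (a, b) = v}
        = measure_pmf.prob (map_pmf (\<lambda>c. c (a, b)) ?P) {v}"
      by (simp add: vimage_def)
    moreover have "map_pmf (\<lambda>c. c (a, b)) ?P = bernoulli_pmf (p a b)"
      using ab by (simp add: Pi_pmf_component)
    ultimately show ?thesis
      by (cases v) (simp_all add: measure_pmf_single)
  qed
  show ?thesis
  proof (cases "i < j")
    case True
    then have "coin_tournament n -` {T. (i, j) \<in> parcs T} = {c. c (i, j) = True}"
      using assms by (auto simp: coin_tournament_def alt_pairs_def)
    then show ?thesis
      using True assms coin[of i j True] by (simp add: random_tournament_def alt_pairs_def)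
  next
    case False
    then have "coin_tournament n -` {T. (i, j) \<in> parcs T} = {c. c (j, i) = False}"
      using assms by (auto simp: coin_tournament_def alt_pairs_def)
    moreover have "p i j = 1 - p j i"
      using assms unfolding pairwise_probs_def by (smt (verit))
    ultimately show ?thesis
      using False assms coin[of j i False] by (simp add: random_tournament_def alt_pairs_def)
  qed
qed

end

theory Submission
  imports Defs
begin

text \<open>
  Split the alternatives into a set \<open>S\<close> and its complement \<open>L\<close>, and fix the outcomes inside \<open>S\<close>
  and inside \<open>L\<close>. If \<open>x \<in> S\<close> has \<open>d\<close> out-neighbours in \<open>S\<close> and \<open>v \<in> L\<close> has at least \<open>n/24\<close>
  in-neighbours in \<open>L\<close>, then the probability that no arc leads from \<open>x\<close> or its out-neighbours to
  the in-neighbours of \<open>v\<close> is at most \<open>s ^ (d + 1)\<close> with \<open>s = exp (- p n / 24)\<close>; otherwise \<open>v\<close> is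
  within distance 3 of \<open>x\<close>. In a tournament small degrees are rare, so \<open>s ^ (d + 1)\<close> summed over
  \<open>S\<close> is \<open>O(s)\<close>, however large \<open>S\<close> is. Markov's inequality then shows that with high probability
  every \<open>x \<in> S\<close> reaches all but about \<open>n/8\<close> elements of \<open>L\<close> within 3 steps.

  Letting \<open>S\<close> range over three sets of size about \<open>n/3\<close>, and applying this also to the reversed
  tournament, one sees that every alternative reaches, and is reached from, more than half of the
  alternatives within 3 steps. Two such majorities meet, which gives paths of length at most 6.
\<close>

subsection \<open>Degrees in tournaments\<close>

text \<open>In- and out-degrees have the same sum and add up to \<open>card W - 1\<close> at every
  vertex, so the average out-degree is half of that, and some vertex attains the average.\<close>

lemma tournament_max_degree:
  assumes "finite W" "W \<noteq> {}" "total_on W R" "asym_on W R"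
  shows "\<exists>x\<in>W. card W \<le> 2 * card {y\<in>W. (x, y) \<in> R} + 1"
proof (rule ccontr)
  assume contra: "\<not> ?thesis"
  have less: "2 * card {y\<in>W. (x, y) \<in> R} < card W - 1" if "x \<in> W" for x
  proof -
    have "\<not> card W \<le> 2 * card {y\<in>W. (x, y) \<in> R} + 1"
      using contra that by blast
    then show ?thesis
      by linarith
  qed
  have deg: "card {y\<in>W. (x, y) \<in> R} + card {y\<in>W. (y, x) \<in> R} = card W - 1" if "x \<in> W" for x
  proof -
    have asym: "(y, x) \<notin> R" if "y \<in> W" "(x, y) \<in> R" for y
      using asym_onD[OF assms(4)] that \<open>x \<in> W\<close> by blast
    have total: "(x, y) \<in> R \<or> (y, x) \<in> R" if "y \<in> W" "y \<noteq> x" for y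
      using assms(3)[unfolded total_on_def, rule_format, of x y] that \<open>x \<in> W\<close> by blast
    have "W - {x} = {y\<in>W. (x, y) \<in> R} \<union> {y\<in>W. (y, x) \<in> R}"
      using asym[OF \<open>x \<in> W\<close>] total by blast
    moreover have "{y\<in>W. (x, y) \<in> R} \<inter> {y\<in>W. (y, x) \<in> R} = {}"
      using asym by blast
    ultimately have "card (W - {x}) = card {y\<in>W. (x, y) \<in> R} + card {y\<in>W. (y, x) \<in> R}"
      using assms(1) by (simp add: card_Un_disjoint)
    then show ?thesis
      using that by simp
  qed
  have "(\<Sum>x\<in>W. card {y\<in>W. (x, y) \<in> R}) = (\<Sum>x\<in>W. card {y\<in>W. (y, x) \<in> R})"
    unfolding card_eq_sum by (rule sum.swap_restrict[OF assms(1) assms(1)])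
  moreover have "(\<Sum>x\<in>W. card {y\<in>W. (x, y) \<in> R}) + (\<Sum>x\<in>W. card {y\<in>W. (y, x) \<in> R})
      = (\<Sum>x\<in>W. card W - 1)"
    unfolding sum.distrib[symmetric] by (rule sum.cong[OF refl deg])
  moreover have "(\<Sum>x\<in>W. 2 * card {y\<in>W. (x, y) \<in> R}) < (\<Sum>x\<in>W. card W - 1)"
    using assms(1,2) less by (rule sum_strict_mono)
  ultimately show False
    unfolding sum_distrib_left[symmetric] by linarith
qed

text \<open>Induction by deleting a vertex of maximum out-degree: it contributes at most
  \<open>r ^ (card W - 1)\<close>, and deletion can only lower the other degrees, hence only raise
  their terms. The base \<open>r\<^sup>2\<close> absorbs the factor 1/2 in the degree bound. The
  right-hand side stays below a geometric series, whatever the size of \<open>W\<close>.\<close>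

lemma tournament_degree_power_sum:
  fixes r :: real
  assumes "finite W" "total_on W R" "asym_on W R" "0 \<le> r" "r \<le> 1"
  shows "(\<Sum>x\<in>W. (r\<^sup>2) ^ card {y\<in>W. (x, y) \<in> R}) \<le> (\<Sum>i<card W. r ^ i)"
  using assms(1-3)
proof (induction "card W" arbitrary: W)
  case 0
  then show ?case by simp
next
  case (Suc k)
  then have "W \<noteq> {}" by auto
  then obtain x where x: "x \<in> W" "card W \<le> 2 * card {y\<in>W. (x, y) \<in> R} + 1"
    using tournament_max_degree Suc.prems by blast
  have "(r\<^sup>2) ^ card {y\<in>W. (x, y) \<in> R} = r ^ (2 * card {y\<in>W. (x, y) \<in> R})"
    by (simp add: power_mult)
  also have "\<dots> \<le> r ^ k"
    using x(2) Suc.hyps(2) assms(4,5) by (intro power_decreasing) auto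
  finally have max: "(r\<^sup>2) ^ card {y\<in>W. (x, y) \<in> R} \<le> r ^ k" .
  have "(\<Sum>z\<in>W - {x}. (r\<^sup>2) ^ card {y\<in>W. (z, y) \<in> R})
      \<le> (\<Sum>z\<in>W - {x}. (r\<^sup>2) ^ card {y\<in>W - {x}. (z, y) \<in> R})"
    using Suc.prems(1) assms(4,5)
    by (intro sum_mono power_decreasing card_mono) (auto simp: power_le_one)
  also have "\<dots> \<le> (\<Sum>i<card (W - {x}). r ^ i)"
    using Suc x(1) by (intro Suc.hyps(1)) (auto intro: total_on_subset asym_on_subset)
  also have "card (W - {x}) = k"
    using Suc.hyps(2) x(1) by simp
  finally have "(\<Sum>z\<in>W. (r\<^sup>2) ^ card {y\<in>W. (z, y) \<in> R}) \<le> (\<Sum>i<Suc k. r ^ i)"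
    using max Suc.prems(1) x(1) by (simp add: sum.remove)
  then show ?case using Suc.hyps(2) by simp
qed

text \<open>The vertices of low in-degree form a tournament of their own, in which some vertex
  already has in-degree at least \<open>(card W - 1) / 2\<close>.\<close>

lemma card_low_indegree:
  fixes t :: real
  assumes "finite L" "total_on L R" "asym_on L R" "t > 0"
  shows "real (card {v\<in>L. real (card {u\<in>L. (u, v) \<in> R}) < t}) \<le> 2 * t + 1"
proof -
  define W where "W = {v\<in>L. real (card {u\<in>L. (u, v) \<in> R}) < t}"
  have sub: "W \<subseteq> L" and fin: "finite W"
    using assms(1) by (auto simp: W_def)
  have "total_on W (R\<inverse>)" "asym_on W (R\<inverse>)"
    using assms(2,3) sub unfolding total_on_def asym_on_def by blast+
  then have "real (card W) \<le> 2 * t + 1"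
  proof (cases "W = {}")
    case False
    then obtain x where x: "x \<in> W" "card W \<le> 2 * card {y\<in>W. (x, y) \<in> R\<inverse>} + 1"
      using tournament_max_degree[of W "R\<inverse>"] fin \<open>total_on W _\<close> \<open>asym_on W _\<close> by blast
    have "card {y\<in>W. (x, y) \<in> R\<inverse>} \<le> card {u\<in>L. (u, x) \<in> R}"
      using sub assms(1) by (intro card_mono) auto
    then show ?thesis
      using x unfolding W_def by auto
  qed (use assms(4) in auto)
  then show ?thesis
    by (simp add: W_def)
qed

subsection \<open>Walks and kings\<close>

lemma converse_relpow_reflcl: "((R\<inverse>)\<^sup>=) ^^ m = ((R\<^sup>=) ^^ m)\<inverse>"
proof (induction m)
  case (Suc m)
  have "((R\<inverse>)\<^sup>=) ^^ Suc m = ((R\<^sup>=) ^^ m)\<inverse> O (R\<^sup>=)\<inverse>"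
    using Suc by auto
  also have "\<dots> = ((R\<^sup>=) ^^ Suc m)\<inverse>"
    by (simp only: relpow.simps converse_relcomp[symmetric] relpow_commute)
  finally show ?case .
qed simp

text \<open>Powers of the reflexive closure encode walks of length at most \<open>k\<close>, which
  compose more easily than paths; here they are shortened to paths.\<close>

lemma k_king_coin_tournament:
  assumes "x \<in> {1..n}" "\<And>y. y \<in> {1..n} \<Longrightarrow> (x, y) \<in> ((parcs (coin_tournament n c))\<^sup>=) ^^ k"
  shows "k_king k (coin_tournament n c) x"
proof -
  let ?T = "coin_tournament n c"
  interpret pair_fin_digraph ?T
    using tournament_coin_tournament[of n c] by (simp add: tournament_def)
  have V: "pverts ?T = {1..n}"
    by (simp add: coin_tournament_def)
  have walk: "\<exists>w. awalk x w y \<and> length w \<le> m" if "(x, y) \<in> ((parcs ?T)\<^sup>=) ^^ m" for m y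
    using that
  proof (induction m arbitrary: y)
    case 0
    then have "awalk x [] y"
      using assms(1) V by (simp add: awalk_def)
    then show ?case by auto
  next
    case (Suc m)
    then obtain z where z: "(x, z) \<in> ((parcs ?T)\<^sup>=) ^^ m" "(z, y) \<in> (parcs ?T)\<^sup>="
      by auto
    from Suc.IH[OF z(1)] obtain w where w: "awalk x w z" "length w \<le> m"
      by blast
    show ?case
    proof (cases "z = y")
      case True
      then show ?thesis using w le_SucI by blast
    next
      case False
      then have "awalk z [(z, y)] y"
        using z(2) by (auto simp: awalk_def in_arcsD1)
      then have "awalk x (w @ [(z, y)]) y"
        using w(1) by (rule awalk_appendI[rotated])
      then show ?thesis using w(2) by (intro exI[of _ "w @ [(z, y)]"]) simp
    qed
  qed
  have "\<exists>w. apath x w y \<and> length w \<le> k" if y: "y \<in> {1..n}" for y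
  proof -
    obtain w where w: "awalk x w y" "length w \<le> k"
      using walk assms(2)[OF y] by blast
    define w' where "w' = awalk_to_apath w"
    have ap: "apath x w' y"
      using apath_awalk_to_apath[OF w(1)] by (simp add: w'_def)
    then have "distinct w'"
      using distinct_verts_imp_distinct unfolding apath_def by blast
    \<comment> \<open>The arcs of the path are distinct and all occur in the walk, so comparing arc
      sets compares the lengths.\<close>
    then have "length w' = card (set w')"
      by (simp add: distinct_card)
    also have "\<dots> \<le> card (set w)"
      using awalk_to_apath_subset[OF w(1)] by (intro card_mono) (auto simp: w'_def)
    also have "\<dots> \<le> k"
      using w(2) card_length[of w] by linarith
    finally show ?thesis using ap by blast
  qed
  then show ?thesis
    using assms(1) V by (auto simp: k_king_def)
qed

subsection \<open>Arcs between disjoint sets\<close>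

text \<open>Markov's inequality for the count, written as a sum of indicators.\<close>

lemma prob_card_ge:
  fixes t :: real
  assumes "finite V" "t > 0"
  shows "measure_pmf.prob M {c. t \<le> real (card {v\<in>V. Q v c})}
    \<le> (\<Sum>v\<in>V. measure_pmf.prob M {c. Q v c}) / t"
proof -
  have count: "real (card {v\<in>V. Q v c}) = (\<Sum>v\<in>V. indicator {c. Q v c} c)" for c
    using assms(1) by (simp add: indicator_def sum.If_cases Int_def)
  have "measure_pmf.prob M {c\<in>space (measure_pmf M). t \<le> (\<Sum>v\<in>V. indicator {c. Q v c} c)}
      \<le> measure_pmf.expectation M (\<lambda>c. \<Sum>v\<in>V. indicator {c. Q v c} c) / t"
    using assms(2)
    by (intro integral_Markov_inequality_measure Bochner_Integration.integrable_sum)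
       (auto intro!: sum_nonneg simp: integrable_indicator_iff less_top[symmetric])
  also have "measure_pmf.expectation M (\<lambda>c. \<Sum>v\<in>V. indicator {c. Q v c} c)
      = (\<Sum>v\<in>V. measure_pmf.prob M {c. Q v c})"
    by (subst Bochner_Integration.integral_sum)
       (auto simp: integrable_indicator_iff less_top[symmetric])
  finally show ?thesis
    by (simp add: count)
qed

text \<open>Conditioning on the second component: a bound valid for each of its values survives
  averaging.\<close>

lemma prob_pair_pmf_le:
  assumes "\<And>y. measure_pmf.prob A {x. (x, y) \<in> E} \<le> b"
  shows "measure_pmf.prob (pair_pmf A B) E \<le> b"
proof -
  have "0 \<le> b"
    using assms[of undefined] by (meson measure_nonneg order_trans)
  have "pair_pmf A B = bind_pmf B (\<lambda>y. map_pmf (\<lambda>x. (x, y)) A)"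
    unfolding pair_pmf_def map_pmf_def by (rule bind_commute_pmf)
  then have "emeasure (pair_pmf A B) E
      = (\<integral>\<^sup>+y. ennreal (measure_pmf.prob A {x. (x, y) \<in> E}) \<partial>B)"
    by (simp add: measure_pmf.emeasure_eq_measure[symmetric] vimage_def)
  also have "\<dots> \<le> (\<integral>\<^sup>+y. ennreal b \<partial>B)"
    using assms by (intro nn_integral_mono ennreal_leI)
  also have "\<dots> = ennreal b"
    by (simp add: measure_pmf.emeasure_space_1)
  finally show ?thesis
    using \<open>0 \<le> b\<close> by (simp add: measure_pmf.emeasure_eq_measure)
qed

text \<open>The flag \<open>e\<close> lets one argument serve both the tournament and its reversal,
  that is, both reaching and being reached.\<close>

definition arcs_dir :: "bool \<Rightarrow> nat \<Rightarrow> (nat \<times> nat \<Rightarrow> bool) \<Rightarrow> (nat \<times> nat) set" where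
  "arcs_dir e n c = (if e then parcs (coin_tournament n c) else (parcs (coin_tournament n c))\<inverse>)"

lemma arcs_dir_iff:
  "(i, j) \<in> arcs_dir e n c \<longleftrightarrow>
     i \<in> {1..n} \<and> j \<in> {1..n} \<and> i \<noteq> j \<and> (c (min i j, max i j) \<longleftrightarrow> (i < j) = e)"
  by (cases i j rule: linorder_cases)
     (auto simp: arcs_dir_def coin_tournament_def alt_pairs_def min_def max_def)

lemma asym_arcs_dir: "asym_on A (arcs_dir e n c)"
  by (auto simp: asym_on_def arcs_dir_iff min.commute max.commute)

lemma total_arcs_dir: "A \<subseteq> {1..n} \<Longrightarrow> total_on A (arcs_dir e n c)"
  by (auto simp: total_on_def arcs_dir_iff subset_iff min.commute max.commute)

lemma prob_coin_le:
  fixes q :: real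
  assumes "pairwise_probs n P" "\<And>i j. i \<in> {1..n} \<Longrightarrow> j \<in> {1..n} \<Longrightarrow> i \<noteq> j \<Longrightarrow> q \<le> P i j"
    and "(i, j) \<in> alt_pairs n"
  shows "measure_pmf.prob (bernoulli_pmf (P i j)) {v} \<le> exp (- q)"
proof -
  have ij: "i \<in> {1..n}" "j \<in> {1..n}" "i \<noteq> j"
    using assms(3) by (auto simp: alt_pairs_def)
  then have "P i j \<in> {0..1}" "P i j + P j i = 1" "q \<le> P i j" "q \<le> P j i"
    using assms(1,2) by (auto simp: pairwise_probs_def)
  then have "measure_pmf.prob (bernoulli_pmf (P i j)) {v} \<le> 1 - q"
    by (cases v) (auto simp: measure_pmf_single)
  also have "1 - q \<le> exp (- q)"
    using exp_ge_add_one_self[of "- q"] by simp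
  finally show ?thesis .
qed

text \<open>Disjointness of \<open>A\<close> and \<open>B\<close> gives every pair its own coin, so
  the absence of all arcs prescribes \<open>card A * card B\<close> independent coins, each at a
  cost of at most \<open>exp (- q)\<close>.\<close>

lemma prob_no_arc_le:
  fixes q :: real
  assumes P: "pairwise_probs n P"
      "\<And>i j. i \<in> {1..n} \<Longrightarrow> j \<in> {1..n} \<Longrightarrow> i \<noteq> j \<Longrightarrow> q \<le> P i j"
    and C: "C \<subseteq> alt_pairs n"
    and AB: "A \<inter> B = {}" "\<And>a b. a \<in> A \<Longrightarrow> b \<in> B \<Longrightarrow> (min a b, max a b) \<in> C"
  shows "measure_pmf.prob (Pi_pmf C False (\<lambda>(i, j). bernoulli_pmf (P i j)))
           {c. \<forall>a\<in>A. \<forall>b\<in>B. (a, b) \<notin> arcs_dir e n c} \<le> exp (- q) ^ (card A * card B)"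
    (is "measure_pmf.prob ?M ?X \<le> _")
proof -
  define E where "E = (\<lambda>(a, b). (min a b, max a b)) ` (A \<times> B)"
  \<comment> \<open>The prescribed value of a coin depends on whether its smaller endpoint lies on
    the source side \<open>A\<close> and on the direction \<open>e\<close>.\<close>
  define V where "V = (\<lambda>(i, j). if (i, j) \<in> E then {(i \<in> A) \<noteq> e} else UNIV)"
  have fin: "finite C"
    using C by (rule finite_subset) simp
  have EC: "E \<subseteq> C"
    using AB(2) by (auto simp: E_def)
  have "inj_on (\<lambda>(a, b). (min a b, max a b)) (A \<times> B)"
    using AB(1) by (auto simp: inj_on_def min_def max_def split: if_splits)
  then have cardE: "card E = card A * card B"
    by (simp add: E_def card_image card_cartesian_product)
  have "?X \<subseteq> Pi C V"
  proof
    fix c assume c: "c \<in> ?X"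
    have "c x \<in> V x" for x
    proof (cases "x \<in> E")
      case True
      then obtain a b where ab: "a \<in> A" "b \<in> B" "x = (min a b, max a b)"
        by (auto simp: E_def)
      then have "x \<in> alt_pairs n"
        using EC C True by auto
      then have "a \<in> {1..n}" "b \<in> {1..n}" "a \<noteq> b"
        using ab(3) by (auto simp: alt_pairs_def min_def max_def split: if_splits)
      moreover have "b \<notin> A"
        using ab AB(1) by auto
      moreover have "(a, b) \<notin> arcs_dir e n c"
        using c ab by auto
      ultimately show ?thesis
        using ab True by (cases "a < b") (auto simp: arcs_dir_iff V_def min_def max_def)
    qed (auto simp: V_def split: prod.splits)
    then show "c \<in> Pi C V" by auto
  qed
  then have "measure_pmf.prob ?M ?X \<le> measure_pmf.prob ?M (Pi C V)"
    by (intro measure_pmf.finite_measure_mono) auto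
  also have "\<dots> = (\<Prod>x\<in>C. measure_pmf.prob (case x of (i, j) \<Rightarrow> bernoulli_pmf (P i j)) (V x))"
    by (rule measure_Pi_pmf_Pi[OF fin])
  also have "\<dots> = (\<Prod>x\<in>E. measure_pmf.prob (case x of (i, j) \<Rightarrow> bernoulli_pmf (P i j)) (V x))"
    using EC fin by (intro prod.mono_neutral_right) (auto simp: V_def)
  also have "\<dots> \<le> (\<Prod>x\<in>E. exp (- q))"
    using prob_coin_le[OF P] EC C by (intro prod_mono) (auto simp: V_def)
  also have "\<dots> = exp (- q) ^ (card A * card B)"
    by (simp add: cardE)
  finally show ?thesis .
qed

subsection \<open>Reaching a majority in three steps\<close>

text \<open>Given the coins inside the two sides, only the crossing coins are random. The exponent
  has 48 rather than 24 so that \<open>r\<^sup>2\<close> is the base in the degree power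
  sum.\<close>

lemma prob_short_reach_le:
  fixes q :: real and n :: nat
  defines "r \<equiv> exp (- q * real n / 48)"
  assumes P: "pairwise_probs n P"
      "\<And>i j. i \<in> {1..n} \<Longrightarrow> j \<in> {1..n} \<Longrightarrow> i \<noteq> j \<Longrightarrow> q \<le> P i j"
    and "0 < q" "0 < n" "S \<subseteq> {1..n}"
  shows "measure_pmf.prob (Pi_pmf (alt_pairs n) False (\<lambda>(i, j). bernoulli_pmf (P i j)))
      {c. \<exists>x\<in>S. real n / 8 + 1
          \<le> real (card {v\<in>{1..n} - S. (x, v) \<notin> ((arcs_dir e n c)\<^sup>=) ^^ 3})}
    \<le> 24 * r\<^sup>2 / (1 - r)"
    (is "measure_pmf.prob _ {c. ?bad c} \<le> _")
proof -
  define L where "L = {1..n} - S"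
  define C where "C = {(i, j) \<in> alt_pairs n. (i \<in> S) \<noteq> (j \<in> S)}"
  define D where "D = alt_pairs n - C"
  let ?b = "\<lambda>(i, j). bernoulli_pmf (P i j)"
  let ?comb = "\<lambda>f g x. if x \<in> C then f x else (g x :: bool)"
  have fin: "finite S" "finite L" "finite C" "finite D"
    using assms(6) by (auto simp: L_def C_def D_def finite_subset intro: finite_subset[of _ "alt_pairs n"])
  have r01: "0 < r" "r < 1"
    using assms(4,5) by (auto simp: r_def)
  have crossC: "(min a b, max a b) \<in> C" if "a \<in> S" "b \<in> L" for a b
    using that assms(6)
    by (cases a b rule: linorder_cases) (auto simp: C_def L_def alt_pairs_def min_def max_def)
  have withinC: "(min a b, max a b) \<notin> C" if "(a \<in> S) = (b \<in> S)" for a b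
    using that by (auto simp: C_def min_def max_def)
  \<comment> \<open>\<open>g\<close> holds the coins inside \<open>S\<close> and inside \<open>L\<close>, \<open>f\<close> those between \<open>S\<close> and \<open>L\<close>.\<close>
  have fixed: "measure_pmf.prob (Pi_pmf C False ?b) {f. ?bad (?comb f g)}
      \<le> 24 * r\<^sup>2 / (1 - r)" for g
  proof -
    define G where "G = arcs_dir e n g"
    \<comment> \<open>Including \<open>x\<close> itself guarantees at least one source; the
      resulting extra factor \<open>r\<^sup>2\<close> is what makes the final bound tend to
      0.\<close>
    define out where "out x = insert x {y\<in>S. (x, y) \<in> G}" for x
    define inn where "inn v = {u\<in>L. (u, v) \<in> G}" for v
    define H where "H = {v\<in>L. real n / 24 \<le> real (card (inn v))}"
    define Q where "Q x v f \<longleftrightarrow> (\<forall>a\<in>out x. \<forall>b\<in>inn v. (a, b) \<notin> arcs_dir e n f)" for x v f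
    have finH: "finite H" and HL: "H \<subseteq> L"
      using fin by (auto simp: H_def)
    have low: "real (card (L - H)) \<le> real n / 12 + 1"
    proof -
      have "L - H = {v\<in>L. real (card {u\<in>L. (u, v) \<in> G}) < real n / 24}"
        by (auto simp: H_def inn_def)
      moreover have "total_on L G" "asym_on L G"
        unfolding G_def L_def by (auto intro!: total_arcs_dir asym_arcs_dir)
      ultimately show ?thesis
        using card_low_indegree[of L G "real n / 24"] fin(2) assms(5) by simp
    qed
    \<comment> \<open>Of the \<open>n / 8 + 1\<close> missed elements at most
      \<open>n / 12 + 1\<close> lie outside \<open>H\<close>, which leaves \<open>n / 24\<close>
      inside.\<close>
    have missed: "real n / 24 \<le> real (card {v\<in>H. Q x v f})"
      if x: "x \<in> S" and large: "real n / 8 + 1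
          \<le> real (card {v\<in>{1..n} - S. (x, v) \<notin> ((arcs_dir e n (?comb f g))\<^sup>=) ^^ 3})" for x f
    proof -
      let ?R = "arcs_dir e n (?comb f g)"
      \<comment> \<open>A step inside \<open>S\<close> (possibly trivial), a crossing arc, a step
        inside \<open>L\<close>: the outer two are decided by \<open>g\<close>, the middle one by
        \<open>f\<close>.\<close>
      have "(x, v) \<in> (?R\<^sup>=) ^^ 3" if v: "v \<in> L" "\<not> Q x v f" for v
      proof -
        obtain a b where ab: "a \<in> out x" "b \<in> inn v" "(a, b) \<in> arcs_dir e n f"
          using v(2) by (auto simp: Q_def)
        have "a \<in> S" "b \<in> L" "v \<notin> S" "b \<notin> S"
          using ab x v by (auto simp: out_def inn_def L_def)
        then have "(x, a) \<in> ?R\<^sup>=" "(a, b) \<in> ?R" "(b, v) \<in> ?R"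
          using ab x crossC[of a b] withinC[of x a] withinC[of b v]
          by (auto simp: out_def inn_def G_def arcs_dir_iff)
        then have "(x, v) \<in> ?R\<^sup>= O ?R\<^sup>= O ?R\<^sup>="
          by blast
        then show ?thesis
          by (simp add: numeral_3_eq_3 O_assoc del: reflcl_set_eq)
      qed
      then have "{v\<in>{1..n} - S. (x, v) \<notin> (?R\<^sup>=) ^^ 3} \<subseteq> (L - H) \<union> {v\<in>H. Q x v f}"
        unfolding L_def by blast
      then have "card {v\<in>{1..n} - S. (x, v) \<notin> (?R\<^sup>=) ^^ 3}
          \<le> card ((L - H) \<union> {v\<in>H. Q x v f})"
        using fin(2) finH by (intro card_mono) auto
      also have "\<dots> \<le> card (L - H) + card {v\<in>H. Q x v f}"
        by (rule card_Un_le)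
      finally show ?thesis
        using large low by linarith
    qed
    have prob_Q: "measure_pmf.prob (Pi_pmf C False ?b) {f. Q x v f} \<le> (r\<^sup>2) ^ card (out x)"
      if "x \<in> S" "v \<in> H" for x v
    proof -
      have "measure_pmf.prob (Pi_pmf C False ?b) {f. Q x v f}
          \<le> exp (- q) ^ (card (out x) * card (inn v))"
        unfolding Q_def using that crossC
        by (intro prob_no_arc_le[OF P]) (auto simp: C_def out_def inn_def L_def)
      also have "\<dots> = exp (- q * real (card (inn v))) ^ card (out x)"
        by (simp add: exp_of_nat_mult[symmetric] mult_ac)
      also have "\<dots> \<le> exp (- q * (real n / 24)) ^ card (out x)"
        using that assms(4) by (intro power_mono) (auto simp: H_def)
      also have "exp (- q * (real n / 24)) = r\<^sup>2"
        by (simp add: r_def exp_double[symmetric])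
      finally show ?thesis .
    qed
    have card_out: "card (out x) = Suc (card {y\<in>S. (x, y) \<in> G})" for x
      using fin(1) by (auto simp: out_def G_def arcs_dir_iff)
    have "{f. ?bad (?comb f g)} \<subseteq> (\<Union>x\<in>S. {f. real n / 24 \<le> real (card {v\<in>H. Q x v f})})"
      using missed by blast
    then have "measure_pmf.prob (Pi_pmf C False ?b) {f. ?bad (?comb f g)}
        \<le> measure_pmf.prob (Pi_pmf C False ?b)
            (\<Union>x\<in>S. {f. real n / 24 \<le> real (card {v\<in>H. Q x v f})})"
      by (intro measure_pmf.finite_measure_mono) auto
    also have "\<dots> \<le> (\<Sum>x\<in>S. measure_pmf.prob (Pi_pmf C False ?b)
            {f. real n / 24 \<le> real (card {v\<in>H. Q x v f})})"
      using fin(1) by (intro measure_pmf.finite_measure_subadditive_finite) auto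
    also have "\<dots> \<le> (\<Sum>x\<in>S. 24 * r\<^sup>2 * (r\<^sup>2) ^ card {y\<in>S. (x, y) \<in> G})"
    proof (rule sum_mono)
      fix x assume x: "x \<in> S"
      have "measure_pmf.prob (Pi_pmf C False ?b) {f. real n / 24 \<le> real (card {v\<in>H. Q x v f})}
          \<le> (\<Sum>v\<in>H. measure_pmf.prob (Pi_pmf C False ?b) {f. Q x v f}) / (real n / 24)"
        using finH assms(5) by (intro prob_card_ge) auto
      \<comment> \<open>The number of targets, at most \<open>n\<close>, cancels against the Markov
        threshold \<open>n / 24\<close>, leaving the constant 24.\<close>
      also have "\<dots> \<le> (real n * (r\<^sup>2) ^ card (out x)) / (real n / 24)"
      proof (rule divide_right_mono)
        have "(\<Sum>v\<in>H. measure_pmf.prob (Pi_pmf C False ?b) {f. Q x v f})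
            \<le> real (card H) * (r\<^sup>2) ^ card (out x)"
          using prob_Q[OF x] by (rule sum_bounded_above)
        also have "card H \<le> card {1..n}"
          using HL by (intro card_mono) (auto simp: L_def)
        finally show "(\<Sum>v\<in>H. measure_pmf.prob (Pi_pmf C False ?b) {f. Q x v f})
            \<le> real n * (r\<^sup>2) ^ card (out x)"
          by (simp add: mult_right_mono)
      qed simp
      also have "\<dots> = 24 * r\<^sup>2 * (r\<^sup>2) ^ card {y\<in>S. (x, y) \<in> G}"
        using assms(5) by (simp add: card_out)
      finally show "measure_pmf.prob (Pi_pmf C False ?b)
            {f. real n / 24 \<le> real (card {v\<in>H. Q x v f})}
          \<le> 24 * r\<^sup>2 * (r\<^sup>2) ^ card {y\<in>S. (x, y) \<in> G}" .
    qed
    also have "\<dots> = 24 * r\<^sup>2 * (\<Sum>x\<in>S. (r\<^sup>2) ^ card {y\<in>S. (x, y) \<in> G})"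
      by (simp add: sum_distrib_left)
    also have "\<dots> \<le> 24 * r\<^sup>2 * (\<Sum>i<card S. r ^ i)"
      using fin(1) r01 assms(6) unfolding G_def
      by (intro mult_left_mono tournament_degree_power_sum total_arcs_dir asym_arcs_dir) auto
    also have "(\<Sum>i<card S. r ^ i) \<le> 1 / (1 - r)"
      using r01 by (simp add: sum_gp_strict divide_right_mono)
    finally show ?thesis
      by (simp add: mult_left_mono)
  qed
  have "alt_pairs n = C \<union> D"
    by (auto simp: C_def D_def)
  moreover have "C \<inter> D = {}"
    by (auto simp: D_def)
  \<comment> \<open>Crossing and inner coins are independent, so the bound \<open>fixed\<close>,
    uniform in \<open>g\<close>, carries over to all coins.\<close>
  ultimately have "Pi_pmf (alt_pairs n) False ?b
      = map_pmf (\<lambda>(f, g). ?comb f g) (pair_pmf (Pi_pmf C False ?b) (Pi_pmf D False ?b))"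
    using Pi_pmf_union[of C D False ?b] fin(3,4) by (simp add: case_prod_beta')
  then have "measure_pmf.prob (Pi_pmf (alt_pairs n) False ?b) {c. ?bad c}
      = measure_pmf.prob (pair_pmf (Pi_pmf C False ?b) (Pi_pmf D False ?b))
          {(f, g). ?bad (?comb f g)}"
    by (simp add: vimage_def case_prod_beta')
  also have "\<dots> \<le> 24 * r\<^sup>2 / (1 - r)"
    using fixed by (intro prob_pair_pmf_le) simp
  finally show ?thesis .
qed

section \<open>From majorities to 6-kings\<close>

text \<open>Counting all of \<open>S\<close> as missed, a vertex misses fewer than
  \<open>(n / 3 + 2) + (n / 8 + 1)\<close> elements, which is below \<open>n / 2\<close> when
  \<open>n > 72\<close>.\<close>

lemma all_k_kings_of_short_reach:
  assumes n: "72 < n" and cover: "{1..n} = \<Union>\<S>"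
    and small: "\<And>S. S \<in> \<S> \<Longrightarrow> real (card S) \<le> real n / 3 + 2"
    and reach: "\<And>S e x. S \<in> \<S> \<Longrightarrow> x \<in> S \<Longrightarrow>
      real (card {v\<in>{1..n} - S. (x, v) \<notin> ((arcs_dir e n c)\<^sup>=) ^^ 3}) < real n / 8 + 1"
    and x: "x \<in> {1..n}"
  shows "k_king 6 (coin_tournament n c) x"
proof (rule k_king_coin_tournament[OF x])
  let ?R = "\<lambda>e. ((arcs_dir e n c)\<^sup>=) ^^ 3"
  have half: "real n / 2 < real (card {v\<in>{1..n}. (z, v) \<in> ?R e})" if "z \<in> {1..n}" for z e
  proof -
    have "z \<in> \<Union>\<S>"
      using that unfolding cover .
    then obtain S where S: "S \<in> \<S>" "z \<in> S"
      by blast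
    have "{1..n} \<subseteq> S \<union> {v\<in>{1..n} - S. (z, v) \<notin> ?R e} \<union> {v\<in>{1..n}. (z, v) \<in> ?R e}"
      by auto
    moreover have "finite S"
      using S(1) cover by (metis Union_upper finite_atLeastAtMost finite_subset)
    ultimately have "card {1..n} \<le> card (S \<union> {v\<in>{1..n} - S. (z, v) \<notin> ?R e} \<union> {v\<in>{1..n}. (z, v) \<in> ?R e})"
      by (intro card_mono) auto
    also have "\<dots> \<le> card S + card {v\<in>{1..n} - S. (z, v) \<notin> ?R e} + card {v\<in>{1..n}. (z, v) \<in> ?R e}"
      by (meson add_mono_thms_linordered_semiring(3) card_Un_le order_trans)
    finally show ?thesis
      using small[OF S(1)] reach[OF S, of e] n by simp
  qed
  fix y assume y: "y \<in> {1..n}"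
  \<comment> \<open>The second set consists of the vertices that reach \<open>y\<close> within 3
    steps; two sets larger than \<open>n / 2\<close> must meet.\<close>
  have "{v\<in>{1..n}. (x, v) \<in> ?R True} \<inter> {v\<in>{1..n}. (y, v) \<in> ?R False} \<noteq> {}" (is "?X \<inter> ?Y \<noteq> {}")
  proof
    assume "?X \<inter> ?Y = {}"
    then have "card ?X + card ?Y = card (?X \<union> ?Y)"
      by (simp add: card_Un_disjoint)
    also have "\<dots> \<le> card {1..n}"
      by (intro card_mono) auto
    finally show False
      using half[OF x, of True] half[OF y, of False] by simp
  qed
  then obtain z where z: "(x, z) \<in> ?R True" "(y, z) \<in> ?R False"
    by blast
  then have "(z, y) \<in> ?R True"
    by (simp add: arcs_dir_def converse_relpow_reflcl del: reflcl_set_eq)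
  with z(1) have "(x, y) \<in> ((arcs_dir True n c)\<^sup>=) ^^ (3 + 3)"
    by (rule relpow_trans)
  then show "(x, y) \<in> ((parcs (coin_tournament n c))\<^sup>=) ^^ 6"
    by (simp add: arcs_dir_def)
qed

text \<open>Union bound over three parts and two directions: 6 events of probability at most
  \<open>24 * r\<^sup>2 / (1 - r)\<close> give the constant 144.\<close>

lemma prob_all_6_kings_ge:
  fixes q :: real and n :: nat
  defines "r \<equiv> exp (- q * real n / 48)"
  assumes P: "pairwise_probs n P"
      "\<And>i j. i \<in> {1..n} \<Longrightarrow> j \<in> {1..n} \<Longrightarrow> i \<noteq> j \<Longrightarrow> q \<le> P i j"
    and q: "0 < q" and n: "72 < n"
  shows "1 - 144 * r\<^sup>2 / (1 - r)
    \<le> measure_pmf.prob (random_tournament n P) {T. \<forall>x\<in>pverts T. k_king 6 T x}"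
proof -
  let ?M = "Pi_pmf (alt_pairs n) False (\<lambda>(i, j). bernoulli_pmf (P i j))"
  define m where "m = n div 3"
  \<comment> \<open>The last part also takes the remainder of the division by 3, whence the slack 2
    in \<open>small\<close>.\<close>
  define part where "part k = (if k = 0 then {1..m} else if k = 1 then {m + 1..2 * m} else {2 * m + 1..n})"
    for k :: nat
  define bad where "bad = (\<lambda>(k, e). {c. \<exists>x\<in>part k. real n / 8 + 1
          \<le> real (card {v\<in>{1..n} - part k. (x, v) \<notin> ((arcs_dir e n c)\<^sup>=) ^^ 3})})"
  let ?I = "{0, 1, 2 :: nat} \<times> (UNIV :: bool set)"
  have m: "3 * m \<le> n" "n \<le> 3 * m + 2"
    by (auto simp: m_def)
  have cover: "{1..n} = \<Union>(part ` {0, 1, 2})"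
    using m by (auto simp: part_def)
  have sub: "part k \<subseteq> {1..n}" for k
    using m by (auto simp: part_def)
  have small: "real (card S) \<le> real n / 3 + 2" if "S \<in> part ` {0, 1, 2}" for S
    using that m by (auto simp: part_def)
  have good: "\<forall>x\<in>pverts (coin_tournament n c). k_king 6 (coin_tournament n c) x"
    if "c \<notin> (\<Union>i\<in>?I. bad i)" for c
  proof
    fix x assume "x \<in> pverts (coin_tournament n c)"
    then have x: "x \<in> {1..n}"
      by (simp add: coin_tournament_def)
    show "k_king 6 (coin_tournament n c) x"
    proof (rule all_k_kings_of_short_reach[OF n cover small _ x])
      fix S e y assume "S \<in> part ` {0, 1, 2}" "y \<in> S"
      then obtain k where k: "k \<in> {0, 1, 2}" "S = part k" "y \<in> part k"
        by blast
      then have "c \<notin> bad (k, e)"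
        using that by blast
      then show "real (card {v\<in>{1..n} - S. (y, v) \<notin> ((arcs_dir e n c)\<^sup>=) ^^ 3}) < real n / 8 + 1"
        using k by (auto simp: bad_def not_le)
    qed
  qed
  have "measure_pmf.prob ?M (\<Union>i\<in>?I. bad i) \<le> (\<Sum>i\<in>?I. measure_pmf.prob ?M (bad i))"
    by (intro measure_pmf.finite_measure_subadditive_finite) auto
  also have "\<dots> \<le> (\<Sum>i\<in>?I. 24 * r\<^sup>2 / (1 - r))"
  proof (rule sum_mono)
    fix i assume "i \<in> ?I"
    show "measure_pmf.prob ?M (bad i) \<le> 24 * r\<^sup>2 / (1 - r)"
      using prob_short_reach_le[OF P q _ sub] n by (cases i) (simp add: bad_def r_def)
  qed
  also have "\<dots> = 144 * r\<^sup>2 / (1 - r)"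
    by (simp add: card_cartesian_product)
  finally have "1 - 144 * r\<^sup>2 / (1 - r) \<le> measure_pmf.prob ?M (- (\<Union>i\<in>?I. bad i))"
    using measure_pmf.prob_compl[of "\<Union>i\<in>?I. bad i" ?M] by (simp add: Compl_eq_Diff_UNIV)
  also have "\<dots> \<le> measure_pmf.prob ?M
      {c. \<forall>x\<in>pverts (coin_tournament n c). k_king 6 (coin_tournament n c) x}"
    using good by (intro measure_pmf.finite_measure_mono) (blast, simp)
  also have "\<dots> = measure_pmf.prob (random_tournament n P) {T. \<forall>x\<in>pverts T. k_king 6 T x}"
    by (simp add: random_tournament_def vimage_def)
  finally show ?thesis .
qed

theorem theorem4:
  fixes p :: "nat \<Rightarrow> real" and P :: "nat \<Rightarrow> nat \<Rightarrow> nat \<Rightarrow> real"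
  assumes "filterlim (\<lambda>n. real n * p n) at_top sequentially"
    and "\<And>n. pairwise_probs n (P n)"
    and "\<And>n i j. i \<in> {1..n} \<Longrightarrow> j \<in> {1..n} \<Longrightarrow> i \<noteq> j \<Longrightarrow> P n i j \<ge> p n"
  shows "(\<lambda>n. measure_pmf.prob (random_tournament n (P n))
            {T. \<forall>x\<in>pverts T. k_king 6 T x}) \<longlonglongrightarrow> 1"
proof -
  define r where "r n = exp (- p n * real n / 48)" for n
  have "filterlim (\<lambda>n. (1 / 48) * (real n * p n)) at_top sequentially"
    by (rule filterlim_tendsto_pos_mult_at_top[OF tendsto_const _ assms(1)]) simp
  then have "(\<lambda>n. exp (- ((1 / 48) * (real n * p n)))) \<longlonglongrightarrow> 0"
    by (intro filterlim_compose[OF exp_at_bot] filterlim_compose[OF filterlim_uminus_at_bot_at_top])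
  then have r0: "r \<longlonglongrightarrow> 0"
    by (simp add: r_def[abs_def] mult_ac)
  have lower: "(\<lambda>n. 1 - 144 * (r n)\<^sup>2 / (1 - r n)) \<longlonglongrightarrow> 1 - 144 * 0\<^sup>2 / (1 - 0)"
    by (intro tendsto_intros r0) simp
  \<comment> \<open>The finite bound requires \<open>p n > 0\<close>, which the growth hypothesis
    yields only for large \<open>n\<close>.\<close>
  have "\<forall>\<^sub>F n in sequentially. 0 < real n * p n"
    using assms(1) by (simp add: filterlim_at_top_dense)
  then have "\<forall>\<^sub>F n in sequentially. 1 - 144 * (r n)\<^sup>2 / (1 - r n)
      \<le> measure_pmf.prob (random_tournament n (P n)) {T. \<forall>x\<in>pverts T. k_king 6 T x}"
    using eventually_gt_at_top[of 72]
  proof eventually_elim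
    case (elim n)
    then have "0 < p n"
      by (simp add: zero_less_mult_iff)
    then show ?case
      using prob_all_6_kings_ge[OF assms(2) assms(3), of n] elim by (simp add: r_def)
  qed
  then show ?thesis
    by (rule tendsto_sandwich[OF _ _ _ tendsto_const])
       (use lower in \<open>auto simp: measure_pmf.prob_le_1\<close>)
qed

end
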